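(* Let $\langle G,m\rangle$ be a $d$-periodic orbit graph, let $T$ be a spanning tree of $G$ with a chosen root vertex, and let $m_T$ be the corresponding $T$-gain assignment. Then $\langle G,m\rangle$ is generically rigid on $\mathcal T_0^d$ if and only if $\langle G,m_T\rangle$ is generically rigid on $\mathcal T_0^d$.
   Context: A $d$-periodic orbit graph (gain graph) $\langle G,m\rangle$ consists of a finite connected multigraph $G=(V,E)$ (loops and multiple edges allowed), each of whose edges is given an orientation, and a map $m:E\to\mathbb Z^d$. An edge directed from $v_i$ to $v_j$ with gain $m_e$ is written $\{v_i,v_j;m_e\}$ and is identified with $\{v_j,v_i;-m_e\}$. $T$-gains: fix a spanning tree $T$ of $G$ and a root vertex $u$. The $T$-potential $m(v,T)\in\mathbb Z^d$ of a vertex $v$ is the net gain along the unique path in $T$ from $u$ to $v$ (sum of the edge gains, with sign $+1$ or $-1$ according to whether the edge is traversed along or against its orientation). For an edge $e$ directed from $v$ to $w$, the $T$-gain is $m_T(e)=m(v,T)+m(e)-m(w,T)$. The torus is taken to be the unit torus: $\mathcal T_0^d=\mathbb R^d/\mathbb Z^d$, represented by $[0,1)^d$. A framework on $\mathcal T_0^d$ is a pair $(\langle G,m\rangle,p)$ with $p:V\to[0,1)^d$ injective; write $p_i=p(v_i)$. An infinitesimal motion is a map $u:V\to\mathbb R^d$ with $(u_i-u_j)\cdot(p_i-p_j-m_e)=0$ for every edge $e=\{v_i,v_j;m_e\}$; the framework is infinitesimally rigid if all infinitesimal motions are infinitesimal translations ($u_1=\dots=u_{|V|}$). The rigidity matrix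 is the $|E|\times d|V|$ matrix of this linear system: the row of $\{v_i,v_j;m_e\}$ has $p_i-p_j-m_e$ in the $d$ columns of $v_i$, its negative in the columns of $v_j$, and $0$ elsewhere (a loop gives a zero row). Generic: for $k\in\mathbb Z_+$ let $K_k$ be the set of all edges between pairs of vertices of $V$ with gains in $\{-k,\dots,k\}^d$. For each $E'\subset K_k$ whose rows in the rigidity matrix are linearly independent for some $p\in\mathbb R^{d|V|}$, consider the $|E'|\times|E'|$ minors of these rows as polynomials in the coordinates of $p$; each minor not identically zero defines a variety (its zero set). $\mathcal X_k\subset\mathbb R^{d|V|}$ is the (finite) union of all these varieties. $p$ is generic if $p\notin\mathcal X_k$ for all $k$. $\langle G,m\rangle$ is generically rigid on $\mathcal T_0^d$ if $(\langle G,m\rangle,p)$ is infinitesimally rigid on $\mathcal T_0^d$ for all generic $p:V\to[0,1)^d$. *)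

theory Defs
  imports
    "HOL-Analysis.Analysis"
    "Graph_Theory.Digraph_Component"
    "Jordan_Normal_Form.Determinant"
begin

text \<open>
  A \<open>d\<close>-periodic orbit graph is a pair of a finite multigraph \<open>G\<close>, connected as an undirected
  graph, and a gain map \<open>m\<close>. The record \<open>pre_digraph\<close> supplies the orientation of the edges;
  the dimension \<open>d\<close> is the cardinality of the index type \<open>'d\<close>.
\<close>

definition orbit_graph :: "('v, 'e) pre_digraph \<Rightarrow> ('e \<Rightarrow> int ^ 'd) \<Rightarrow> bool" where
  "orbit_graph G m \<longleftrightarrow> fin_digraph G \<and> Digraph_Component.connected G"

section \<open>Spanning trees and T-gains\<close>

text \<open>
  Directed walks in \<open>signed G\<close> are the undirected walks in \<open>G\<close>: the arc \<open>(e, True)\<close> traverses \<open>e\<close>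
  along its orientation, \<open>(e, False)\<close> against it.
\<close>

definition signed :: "('v, 'e) pre_digraph \<Rightarrow> ('v, 'e \<times> bool) pre_digraph" where
  "signed G = \<lparr> verts = verts G, arcs = arcs G \<times> UNIV,
     tail = (\<lambda>(e, s). if s then tail G e else head G e),
     head = (\<lambda>(e, s). if s then head G e else tail G e) \<rparr>"

text \<open>
  The library's \<open>forest\<close> and \<open>spanning_tree\<close> only exclude directed cycles. Here every cycle of the
  underlying undirected multigraph is excluded; requiring the edges of a cycle to be distinct
  rules out going back and forth along one edge.
\<close>

definition undirected_forest :: "('v, 'e) pre_digraph \<Rightarrow> bool" where
  "undirected_forest T \<longleftrightarrow> \<not> (\<exists>w. pre_digraph.cycle (signed T) w \<and> distinct (map fst w))"

definition undirected_spanning_tree ::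
    "('v, 'e) pre_digraph \<Rightarrow> ('v, 'e) pre_digraph \<Rightarrow> bool" where
  "undirected_spanning_tree T G \<longleftrightarrow>
     spanning T G \<and> Digraph_Component.connected T \<and> undirected_forest T"

definition net_gain :: "('e \<Rightarrow> int ^ 'd) \<Rightarrow> ('e \<times> bool) list \<Rightarrow> int ^ 'd" where
  "net_gain m w = (\<Sum>(e, s)\<leftarrow>w. if s then m e else - m e)"

definition T_potential ::
    "('v, 'e) pre_digraph \<Rightarrow> 'v \<Rightarrow> ('e \<Rightarrow> int ^ 'd) \<Rightarrow> 'v \<Rightarrow> int ^ 'd" where
  "T_potential T r m v = net_gain m (THE w. pre_digraph.apath (signed T) r w v)"

definition T_gain ::
    "('v, 'e) pre_digraph \<Rightarrow> ('v, 'e) pre_digraph \<Rightarrow> 'v \<Rightarrow> ('e \<Rightarrow> int ^ 'd) \<Rightarrow> 'e \<Rightarrow> int ^ 'd" where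
  "T_gain G T r m e = T_potential T r m (tail G e) + m e - T_potential T r m (head G e)"

section \<open>Frameworks on the unit torus\<close>

definition real_vec :: "int ^ 'd \<Rightarrow> real ^ 'd" where
  "real_vec g = (\<chi> c. real_of_int (vec_nth g c))"

definition unit_cube :: "(real ^ 'd) set" where
  "unit_cube = {x. \<forall>c. 0 \<le> vec_nth x c \<and> vec_nth x c < 1}"

text \<open>Only the values of a placement or a motion on \<open>verts G\<close> are relevant.\<close>

definition torus_framework ::
    "('v, 'e) pre_digraph \<Rightarrow> ('e \<Rightarrow> int ^ 'd) \<Rightarrow> ('v \<Rightarrow> real ^ 'd) \<Rightarrow> bool" where
  "torus_framework G m p \<longleftrightarrow> orbit_graph G m \<and> p ` verts G \<subseteq> unit_cube \<and> inj_on p (verts G)"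

definition infinitesimal_motion ::
    "('v, 'e) pre_digraph \<Rightarrow> ('e \<Rightarrow> int ^ 'd) \<Rightarrow> ('v \<Rightarrow> real ^ 'd) \<Rightarrow> ('v \<Rightarrow> real ^ 'd) \<Rightarrow> bool" where
  "infinitesimal_motion G m p u \<longleftrightarrow>
     (\<forall>e\<in>arcs G. (u (tail G e) - u (head G e)) \<bullet>
        (p (tail G e) - p (head G e) - real_vec (m e)) = 0)"

definition infinitesimally_rigid ::
    "('v, 'e) pre_digraph \<Rightarrow> ('e \<Rightarrow> int ^ 'd) \<Rightarrow> ('v \<Rightarrow> real ^ 'd) \<Rightarrow> bool" where
  "infinitesimally_rigid G m p \<longleftrightarrow>
     (\<forall>u. infinitesimal_motion G m p u \<longrightarrow> (\<forall>v\<in>verts G. \<forall>w\<in>verts G. u v = u w))"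

section \<open>Generic placements\<close>

text \<open>
  The triple \<open>(v, w, g)\<close> stands for the edge \<open>{v, w; g}\<close>. It is not identified with
  \<open>(w, v, -g)\<close>, but both have the same row in the rigidity matrix, so no independent set of rows
  uses both. Likewise the zero rows of loops never occur in an independent set.
\<close>

type_synonym ('v, 'd) gain_edge = "'v \<times> 'v \<times> (int ^ 'd)"

definition bounded_gain_edges :: "'v set \<Rightarrow> nat \<Rightarrow> ('v, 'd::finite) gain_edge set" where
  "bounded_gain_edges V k =
     {(v, w, g). v \<in> V \<and> w \<in> V \<and> (\<forall>c. - int k \<le> vec_nth g c \<and> vec_nth g c \<le> int k)}"

text \<open>
  The columns of the rigidity matrix are indexed by pairs of a vertex and a coordinate. The sum
  of the two contributions makes the row of a loop zero.
\<close>

fun rigidity_entry :: "('v \<Rightarrow> real ^ 'd) \<Rightarrow> ('v, 'd::finite) gain_edge \<Rightarrow> 'v \<times> 'd \<Rightarrow> real" where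
  "rigidity_entry p (v, w, g) (x, c) =
     (if x = v then vec_nth (p v - p w - real_vec g) c else 0) +
     (if x = w then - vec_nth (p v - p w - real_vec g) c else 0)"

definition independent_rows ::
    "'v set \<Rightarrow> ('v \<Rightarrow> real ^ 'd) \<Rightarrow> ('v, 'd::finite) gain_edge set \<Rightarrow> bool" where
  "independent_rows V p E' \<longleftrightarrow>
     (\<forall>a. (\<forall>col\<in>V \<times> UNIV. (\<Sum>e\<in>E'. a e * rigidity_entry p e col) = 0) \<longrightarrow> (\<forall>e\<in>E'. a e = 0))"

text \<open>
  Rows and columns of a minor are listed in some order. A different order at most changes its sign,
  which affects neither its zero set nor whether it vanishes identically.
\<close>

definition rigidity_minor ::
    "('v, 'd::finite) gain_edge list \<Rightarrow> ('v \<times> 'd) list \<Rightarrow> ('v \<Rightarrow> real ^ 'd) \<Rightarrow> real" where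
  "rigidity_minor es cs p =
     Determinant.det (mat (length es) (length cs) (\<lambda>(i, j). rigidity_entry p (es ! i) (cs ! j)))"

text \<open>
  A minor is a polynomial in the real coordinates of \<open>p\<close>, so it is the zero polynomial iff it
  vanishes at every \<open>q\<close>.
\<close>

definition exceptional_set :: "'v set \<Rightarrow> nat \<Rightarrow> ('v \<Rightarrow> real ^ 'd) set" where
  "exceptional_set V k =
     \<Union> {{p. rigidity_minor es cs p = 0} | es cs.
          distinct es \<and> set es \<subseteq> bounded_gain_edges V k \<and>
          (\<exists>q. independent_rows V q (set es)) \<and>
          distinct cs \<and> set cs \<subseteq> V \<times> UNIV \<and> length cs = length es \<and>
          (\<exists>q. rigidity_minor es cs q \<noteq> 0)}"

definition generic :: "'v set \<Rightarrow> ('v \<Rightarrow> real ^ 'd) \<Rightarrow> bool" where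
  "generic V p \<longleftrightarrow> (\<forall>k\<ge>1. p \<notin> exceptional_set V k)"

definition generically_rigid :: "('v, 'e) pre_digraph \<Rightarrow> ('e \<Rightarrow> int ^ 'd) \<Rightarrow> bool" where
  "generically_rigid G m \<longleftrightarrow>
     (\<forall>p. torus_framework G m p \<and> generic (verts G) p \<longrightarrow> infinitesimally_rigid G m p)"

end

theory Submission
  imports Defs
begin

text \<open>
  A placement is infinitesimally rigid iff some square minor of the rigidity matrix, on all columns
  except those of one fixed vertex, does not vanish there. Such a minor is then not identically
  zero, so it vanishes at no generic placement, inside the unit cube or not: rigidity at one generic
  placement implies rigidity at all of them. Translating each vertex \<open>v\<close> by an integer vector
  \<open>\<pi> v\<close> permutes the rows that occur for the various gains, hence preserves genericity, and turns
  the rigidity matrix of \<open>m\<close> into that of \<open>m e + \<pi> (tail e) - \<pi> (head e)\<close>. The \<open>T\<close>-gains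
  are of this form.
\<close>

section \<open>Square submatrices of a system of linear forms\<close>

text \<open>Each \<open>f e\<close> is a linear form with coefficients \<open>f e c\<close>. The
  lists only fix an order of rows and columns, as matrices are indexed by positions.\<close>

definition square_minor :: "('e \<Rightarrow> 'c \<Rightarrow> real) \<Rightarrow> 'e list \<Rightarrow> 'c list \<Rightarrow> real mat" where
  "square_minor f es cs = mat (length es) (length cs) (\<lambda>(i, j). f (es ! i) (cs ! j))"

lemma sum_set_eq_nth:
  assumes "distinct cs"
  shows "sum h (set cs) = (\<Sum>j<length cs. h (cs ! j))"
  using sum.reindex_bij_betw[OF bij_betw_nth[OF assms refl refl], of h] by simp

lemma square_minor_mult_vec:
  assumes "length es = length cs" "distinct cs" "i < length cs"
  shows "vec_index (square_minor f es cs *\<^sub>v Matrix.vec (length cs) (\<lambda>j. x (cs ! j))) i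
       = (\<Sum>c\<in>set cs. f (es ! i) c * x c)"
  using assms
  by (simp add: square_minor_def sum_set_eq_nth scalar_prod_def atLeast0LessThan)

text \<open>Distinctness makes the position of a column unique, so vectors indexed by positions can
  be traded for functions on columns.\<close>

lemma obtain_coordinate_function:
  assumes "distinct cs" "v \<in> carrier_vec (length cs)"
  obtains x where "v = Matrix.vec (length cs) (\<lambda>j. x (cs ! j))"
proof -
  define x where "x c = vec_index v (THE j. j < length cs \<and> cs ! j = c)" for c
  have "vec_index v j = x (cs ! j)" if "j < length cs" for j
  proof -
    have "(THE j'. j' < length cs \<and> cs ! j' = cs ! j) = j"
      using that assms(1) by (intro the_equality) (auto simp: nth_eq_iff_index_eq)
    then show ?thesis by (simp add: x_def)
  qed
  then have "v = Matrix.vec (length cs) (\<lambda>j. x (cs ! j))"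
    using assms(2) by (intro eq_vecI) auto
  then show thesis by (rule that)
qed

lemma square_minor_carrier:
  assumes "length es = length cs"
  shows "square_minor f es cs \<in> carrier_mat (length cs) (length cs)"
  using assms by (simp add: square_minor_def)

text \<open>Over a field, a square matrix is nonsingular iff its kernel is trivial. Stated with sums
  over sets, the criterion no longer mentions the order of the lists.\<close>

lemma det_square_minor_nonzero_iff:
  assumes "length es = length cs" "distinct cs"
  shows "Determinant.det (square_minor f es cs) \<noteq> 0 \<longleftrightarrow>
    (\<forall>x. (\<forall>e\<in>set es. (\<Sum>c\<in>set cs. f e c * x c) = 0) \<longrightarrow> (\<forall>c\<in>set cs. x c = 0))"
    (is "?D \<longleftrightarrow> ?K")
proof -
  let ?n = "length cs" and ?A = "square_minor f es cs"
  let ?v = "\<lambda>x. Matrix.vec ?n (\<lambda>j. x (cs ! j))"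
  have null: "?A *\<^sub>v ?v x = 0\<^sub>v ?n \<longleftrightarrow> (\<forall>e\<in>set es. (\<Sum>c\<in>set cs. f e c * x c) = 0)" for x
  proof -
    have "?A *\<^sub>v ?v x = 0\<^sub>v ?n \<longleftrightarrow> (\<forall>i<?n. vec_index (?A *\<^sub>v ?v x) i = 0)"
      using square_minor_carrier[OF assms(1), of f] by (auto simp: Matrix.vec_eq_iff)
    also have "\<dots> \<longleftrightarrow> (\<forall>i<?n. (\<Sum>c\<in>set cs. f (es ! i) c * x c) = 0)"
      using square_minor_mult_vec[OF assms] by auto
    also have "\<dots> \<longleftrightarrow> (\<forall>e\<in>set es. (\<Sum>c\<in>set cs. f e c * x c) = 0)"
      using assms(1) by (metis in_set_conv_nth)
    finally show ?thesis .
  qed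
  have zero: "?v x = 0\<^sub>v ?n \<longleftrightarrow> (\<forall>c\<in>set cs. x c = 0)" for x
    by (simp add: Matrix.vec_eq_iff all_set_conv_all_nth)
  have "?D \<longleftrightarrow> (\<forall>v. v \<in> carrier_vec ?n \<longrightarrow> ?A *\<^sub>v v = 0\<^sub>v ?n \<longrightarrow> v = 0\<^sub>v ?n)"
    using det_0_iff_vec_prod_zero_field[OF square_minor_carrier[OF assms(1)], of f] by blast
  also have "\<dots> \<longleftrightarrow> (\<forall>x. ?A *\<^sub>v ?v x = 0\<^sub>v ?n \<longrightarrow> ?v x = 0\<^sub>v ?n)"
    by (metis obtain_coordinate_function[OF assms(2)] vec_carrier)
  finally show ?thesis by (simp add: null zero)
qed

text \<open>A right inverse of the matrix, applied to the vector of right-hand sides, gives the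
  solution.\<close>

lemma square_minor_solvable:
  assumes "length es = length cs" "distinct cs"
    and "Determinant.det (square_minor f es cs) \<noteq> 0"
  obtains x where "\<And>e. e \<in> set es \<Longrightarrow> (\<Sum>c\<in>set cs. f e c * x c) = b e"
proof -
  let ?n = "length cs" and ?A = "square_minor f es cs"
  note A = square_minor_carrier[OF assms(1), of f]
  obtain B where B: "B \<in> carrier_mat ?n ?n" "?A * B = 1\<^sub>m ?n"
    using det_non_zero_imp_unit[OF A assms(3)]
    unfolding Units_def ring_mat_def by auto
  define w where "w = Matrix.vec ?n (\<lambda>i. b (es ! i))"
  have w: "w \<in> carrier_vec ?n" by (simp add: w_def)
  have Aw: "?A *\<^sub>v (B *\<^sub>v w) = w"
    using assoc_mult_mat_vec[OF A B(1) w] B(2) w by simp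
  obtain x where x: "B *\<^sub>v w = Matrix.vec ?n (\<lambda>j. x (cs ! j))"
    using obtain_coordinate_function[OF assms(2)] mult_mat_vec_carrier[OF B(1) w] by blast
  have "(\<Sum>c\<in>set cs. f (es ! i) c * x c) = b (es ! i)" if "i < ?n" for i
    using square_minor_mult_vec[OF assms(1,2) that, of f x, folded x] that
    by (simp add: Aw) (simp add: w_def)
  then have "\<And>e. e \<in> set es \<Longrightarrow> (\<Sum>c\<in>set cs. f e c * x c) = b e"
    using assms(1) by (metis in_set_conv_nth)
  then show thesis by (rule that)
qed

text \<open>The transpose has the same determinant, and its kernel consists of the linear
  dependencies among the rows.\<close>

lemma det_square_minor_nonzero_rows:
  assumes "length es = length cs" "distinct es"
    and "Determinant.det (square_minor f es cs) \<noteq> 0"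
    and "\<forall>c\<in>set cs. (\<Sum>e\<in>set es. a e * f e c) = 0"
  shows "\<forall>e\<in>set es. a e = 0"
proof -
  have "square_minor (\<lambda>c e. f e c) cs es = transpose_mat (square_minor f es cs)"
    using assms(1) by (auto simp: square_minor_def)
  then have "Determinant.det (square_minor (\<lambda>c e. f e c) cs es) \<noteq> 0"
    using assms(3) det_transpose[OF square_minor_carrier[OF assms(1), of f]] by simp
  then show ?thesis
    using det_square_minor_nonzero_iff[OF assms(1)[symmetric] assms(2), of "\<lambda>c e. f e c"] assms(4)
    by (simp add: mult.commute)
qed

text \<open>
  Induction on the columns: the new column \<open>c\<close> determines a vector with entry \<open>1\<close> at \<open>c\<close> that is
  annihilated by the rows chosen so far, and any row that does not annihilate it can be added.
\<close>

lemma exists_nonzero_square_minor: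
  fixes f :: "'e \<Rightarrow> 'c \<Rightarrow> real"
  assumes "distinct cs"
    and "\<And>x. \<forall>e\<in>R. (\<Sum>c\<in>set cs. f e c * x c) = 0 \<Longrightarrow> \<forall>c\<in>set cs. x c = 0"
  shows "\<exists>es. distinct es \<and> set es \<subseteq> R \<and> length es = length cs
            \<and> Determinant.det (square_minor f es cs) \<noteq> 0"
  using assms
proof (induction cs)
  case Nil
  show ?case by (intro exI[of _ "[]"]) (simp add: square_minor_def)
next
  case (Cons c cs)
  have c: "c \<notin> set cs" "distinct cs" using Cons.prems(1) by auto
  have insert: "(\<Sum>d\<in>set (c # cs). f e d * x d) = f e c * x c + (\<Sum>d\<in>set cs. f e d * x d)"
    for e and x :: "'c \<Rightarrow> real"
    using c by simp
  have outside: "(\<Sum>d\<in>set cs. f e d * (x(c := t)) d) = (\<Sum>d\<in>set cs. f e d * x d)"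
    for e t and x :: "'c \<Rightarrow> real"
    using c by (intro sum.cong) auto
  \<comment> \<open>A kernel vector on the shorter column list extends by \<open>0\<close> at
    \<open>c\<close> to one on the longer list.\<close>
  have "\<forall>d\<in>set cs. x d = 0" if "\<forall>e\<in>R. (\<Sum>d\<in>set cs. f e d * x d) = 0" for x
  proof -
    have "\<forall>e\<in>R. (\<Sum>d\<in>set (c # cs). f e d * (x(c := 0)) d) = 0"
      unfolding insert outside using that by simp
    from Cons.prems(2)[OF this] show ?thesis using c by (auto split: if_splits)
  qed
  from Cons.IH[OF c(2) this] obtain es where es: "distinct es" "set es \<subseteq> R"
    "length es = length cs" "Determinant.det (square_minor f es cs) \<noteq> 0"
    by blast
  obtain y where "\<And>e. e \<in> set es \<Longrightarrow> (\<Sum>d\<in>set cs. f e d * y d) = - f e c"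
    using square_minor_solvable[OF es(3) c(2) es(4), of "\<lambda>e. - f e c"] by metis
  moreover define x where "x = y(c := 1)"
  ultimately have x: "(\<Sum>d\<in>set (c # cs). f e d * x d) = 0" if "e \<in> set es" for e
    using that unfolding x_def insert outside by simp
  have "x c = 1" by (simp add: x_def)
  \<comment> \<open>If every row in \<open>R\<close> annihilated \<open>x\<close>, the hypothesis
    would force \<open>x c = 0\<close>.\<close>
  then obtain e where e: "e \<in> R" "(\<Sum>d\<in>set (c # cs). f e d * x d) \<noteq> 0"
    using Cons.prems(2)[of x] by force
  have len: "length (e # es) = length (c # cs)" using es(3) by simp
  have "e \<notin> set es" using e(2) x by blast
  moreover have "Determinant.det (square_minor f (e # es) (c # cs)) \<noteq> 0"
    unfolding det_square_minor_nonzero_iff[OF len Cons.prems(1)]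
  proof (intro allI impI)
    fix z assume z: "\<forall>e'\<in>set (e # es). (\<Sum>d\<in>set (c # cs). f e' d * z d) = 0"
    \<comment> \<open>Subtracting this multiple of \<open>x\<close> clears the entry at
      \<open>c\<close>, so the smaller minor on \<open>es\<close> and \<open>cs\<close> applies to
      \<open>z'\<close>.\<close>
    define z' where "z' d = z d - z c * x d" for d
    have z': "(\<Sum>d\<in>set (c # cs). f e' d * z' d)
        = (\<Sum>d\<in>set (c # cs). f e' d * z d) - z c * (\<Sum>d\<in>set (c # cs). f e' d * x d)" for e'
      unfolding z'_def sum_distrib_left sum_subtractf[symmetric]
      by (intro sum.cong) (auto simp: algebra_simps)
    have zero_c: "z' c = 0" using \<open>x c = 1\<close> by (simp add: z'_def)
    have "(\<Sum>d\<in>set cs. f e' d * z' d) = 0" if "e' \<in> set es" for e'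
      using z' z x insert[of e' z'] zero_c that by simp
    then have "\<forall>d\<in>set cs. z' d = 0"
      using es(4) det_square_minor_nonzero_iff[OF es(3) c(2)] by blast
    then have all: "\<forall>d\<in>set (c # cs). z' d = 0" using zero_c by simp
    then have "(\<Sum>d\<in>set (c # cs). f e d * z' d) = 0"
      by (intro sum.neutral) simp
    moreover have "(\<Sum>d\<in>set (c # cs). f e d * z d) = 0"
      using z by (meson list.set_intros(1))
    ultimately have "z c * (\<Sum>d\<in>set (c # cs). f e d * x d) = 0"
      using z'[of e] by linarith
    then have "z c = 0" using e(2) by simp
    then show "\<forall>d\<in>set (c # cs). z d = 0" using all by (simp add: z'_def)
  qed
  ultimately show ?case
    using es e(1) by (intro exI[of _ "e # es"]) simp
qed

section \<open>Rigidity and minors of the rigidity matrix\<close>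

lemma rigidity_minor_eq:
  "rigidity_minor es cs p = Determinant.det (square_minor (rigidity_entry p) es cs)"
  by (simp add: rigidity_minor_def square_minor_def)

text \<open>Parallel edges with equal gain are merged. They have equal rows, so the kernel of the
  rigidity matrix is the same.\<close>

definition gain_edges ::
    "('v, 'e) pre_digraph \<Rightarrow> ('e \<Rightarrow> int ^ 'd) \<Rightarrow> ('v, 'd::finite) gain_edge set" where
  "gain_edges G m = (\<lambda>e. (tail G e, head G e, m e)) ` arcs G"

text \<open>The row is a sum of a block at \<open>v\<close> and the opposite block at
  \<open>w\<close>. Evaluating the two separately also covers loops, where they cancel.\<close>

lemma rigidity_row_mult:
  assumes "finite V" "v \<in> V" "w \<in> V"
  shows "(\<Sum>(x, c)\<in>V \<times> UNIV. rigidity_entry p (v, w, g) (x, c) * vec_nth (u x) c)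
    = inner (u v - u w) (p v - p w - real_vec g)"
proof -
  define b where "b = p v - p w - real_vec g"
  have entry: "rigidity_entry p (v, w, g) (x, c)
      = (if x = v then vec_nth b c else 0) - (if x = w then vec_nth b c else 0)" for x c
    by (simp add: b_def)
  have "(\<Sum>(x, c)\<in>V \<times> UNIV. rigidity_entry p (v, w, g) (x, c) * vec_nth (u x) c)
      = (\<Sum>x\<in>V. (if x = v then inner b (u x) else 0) - (if x = w then inner b (u x) else 0))"
    unfolding sum.cartesian_product[symmetric] entry
    by (intro sum.cong) (auto simp: inner_vec_def sum_negf)
  also have "\<dots> = inner b (u v) - inner b (u w)"
    using assms by (simp add: sum_subtractf)
  finally show ?thesis by (simp add: b_def inner_diff_right inner_commute)
qed

lemma infinitesimal_motion_iff_rows: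
  assumes "fin_digraph G"
  shows "infinitesimal_motion G m p u \<longleftrightarrow>
    (\<forall>e\<in>gain_edges G m.
      (\<Sum>(x, c)\<in>verts G \<times> UNIV. rigidity_entry p e (x, c) * vec_nth (u x) c) = 0)"
proof -
  interpret fin_digraph G by fact
  show ?thesis
    unfolding infinitesimal_motion_def gain_edges_def
    by (simp add: rigidity_row_mult del: rigidity_entry.simps)
qed

text \<open>Subtracting a translation, one may assume that a motion vanishes at \<open>r\<close>.\<close>

lemma infinitesimally_rigid_iff_kernel:
  assumes "fin_digraph G" "r \<in> verts G"
  shows "infinitesimally_rigid G m p \<longleftrightarrow>
    (\<forall>x. (\<forall>e\<in>gain_edges G m. (\<Sum>c\<in>(verts G - {r}) \<times> UNIV. rigidity_entry p e c * x c) = 0)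
      \<longrightarrow> (\<forall>c\<in>(verts G - {r}) \<times> UNIV. x c = 0))" (is "_ \<longleftrightarrow> ?K")
proof -
  interpret fin_digraph G by fact
  let ?V = "verts G" and ?C = "(verts G - {r}) \<times> (UNIV :: 'c set)"
  have motion: "infinitesimal_motion G m p u \<longleftrightarrow>
      (\<forall>e\<in>gain_edges G m. (\<Sum>(x, c)\<in>?C. rigidity_entry p e (x, c) * vec_nth (u x) c) = 0)"
    if "u r = 0" for u
  proof -
    have "(\<Sum>(x, c)\<in>?V \<times> UNIV. rigidity_entry p e (x, c) * vec_nth (u x) c)
        = (\<Sum>(x, c)\<in>?C. rigidity_entry p e (x, c) * vec_nth (u x) c)" for e
      using that by (intro sum.mono_neutral_right) auto
    then show ?thesis
      unfolding infinitesimal_motion_iff_rows[OF assms(1)] by simp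
  qed
  show ?thesis
  proof
    assume rigid: "infinitesimally_rigid G m p"
    show ?K
    proof (intro allI impI)
      fix x :: "'a \<times> 'c \<Rightarrow> real"
      assume x: "\<forall>e\<in>gain_edges G m. (\<Sum>c\<in>?C. rigidity_entry p e c * x c) = 0"
      \<comment> \<open>The value \<open>0\<close> at \<open>r\<close> makes the deleted columns
        contribute nothing.\<close>
      define u where "u v = (if v = r then 0 else (\<chi> c. x (v, c)))" for v
      have "u r = 0" by (simp add: u_def)
      have "(\<Sum>(v, c)\<in>?C. rigidity_entry p e (v, c) * vec_nth (u v) c)
          = (\<Sum>c\<in>?C. rigidity_entry p e c * x c)" for e
        by (intro sum.cong refl) (simp add: u_def mem_Times_iff split_beta)
      with x have "infinitesimal_motion G m p u"
        unfolding motion[of u, OF \<open>u r = 0\<close>] by simp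
      then have "\<forall>v\<in>?V. u v = 0"
        using rigid assms(2) \<open>u r = 0\<close> unfolding infinitesimally_rigid_def by metis
      then show "\<forall>c\<in>?C. x c = 0"
        by (auto simp: u_def Finite_Cartesian_Product.vec_eq_iff split: if_splits)
    qed
  next
    assume K: ?K
    show "infinitesimally_rigid G m p"
      unfolding infinitesimally_rigid_def
    proof (intro allI impI ballI)
      fix u v w assume u: "infinitesimal_motion G m p u" and vw: "v \<in> ?V" "w \<in> ?V"
      define u' where "u' v = u v - u r" for v
      have "infinitesimal_motion G m p u'"
        using u unfolding infinitesimal_motion_def u'_def by simp
      then have row: "\<forall>e\<in>gain_edges G m.
          (\<Sum>c\<in>?C. rigidity_entry p e c * vec_nth (u' (fst c)) (snd c)) = 0"
        using motion[of u'] by (simp add: u'_def case_prod_beta)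
      have "\<forall>c\<in>?C. vec_nth (u' (fst c)) (snd c) = 0"
        using K[rule_format, of "\<lambda>c. vec_nth (u' (fst c)) (snd c)"] row by blast
      then have "u' v = 0" if "v \<in> ?V" for v
        using that by (cases "v = r") (auto simp: Finite_Cartesian_Product.vec_eq_iff u'_def)
      then have "u' v = 0" "u' w = 0" using vw by blast+
      then show "u v = u w" by (simp add: u'_def)
    qed
  qed
qed

text \<open>A trivial kernel yields enough rows for a nonzero minor on all columns in
  \<open>cs\<close>; conversely, the rows of such a minor alone already force the kernel to be
  trivial.\<close>

lemma infinitesimally_rigid_iff_minor:
  assumes "fin_digraph G" "r \<in> verts G"
    and "distinct cs" "set cs = (verts G - {r}) \<times> UNIV"
  shows "infinitesimally_rigid G m p \<longleftrightarrow>
    (\<exists>es. distinct es \<and> set es \<subseteq> gain_edges G m \<and> length es = length cs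
        \<and> rigidity_minor es cs p \<noteq> 0)"
proof
  assume "infinitesimally_rigid G m p"
  then show "\<exists>es. distinct es \<and> set es \<subseteq> gain_edges G m \<and> length es = length cs
        \<and> rigidity_minor es cs p \<noteq> 0"
    unfolding infinitesimally_rigid_iff_kernel[OF assms(1,2)] assms(4)[symmetric] rigidity_minor_eq
    using exists_nonzero_square_minor[OF assms(3), of "gain_edges G m" "rigidity_entry p"] by simp
next
  assume "\<exists>es. distinct es \<and> set es \<subseteq> gain_edges G m \<and> length es = length cs
        \<and> rigidity_minor es cs p \<noteq> 0"
  then obtain es where es: "set es \<subseteq> gain_edges G m" "length es = length cs"
      "Determinant.det (square_minor (rigidity_entry p) es cs) \<noteq> 0"
    unfolding rigidity_minor_eq by blast
  then show "infinitesimally_rigid G m p"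
    unfolding infinitesimally_rigid_iff_kernel[OF assms(1,2)] assms(4)[symmetric]
    using det_square_minor_nonzero_iff[OF es(2) assms(3), of "rigidity_entry p"] by blast
qed

text \<open>A dependency among the rows restricts to the columns in \<open>cs\<close>, where the
  minor excludes it. This supplies the independence condition in
  \<open>exceptional_set\<close>.\<close>

lemma independent_rows_if_minor_nonzero:
  assumes "distinct es" "length cs = length es" "set cs \<subseteq> V \<times> UNIV"
    and "rigidity_minor es cs p \<noteq> 0"
  shows "independent_rows V p (set es)"
  unfolding independent_rows_def
proof (intro allI impI)
  fix a assume "\<forall>c\<in>V \<times> UNIV. (\<Sum>e\<in>set es. a e * rigidity_entry p e c) = 0"
  then have "\<forall>c\<in>set cs. (\<Sum>e\<in>set es. a e * rigidity_entry p e c) = 0"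
    using assms(3) by blast
  then show "\<forall>e\<in>set es. a e = 0"
    using det_square_minor_nonzero_rows[of es cs "rigidity_entry p" a] assms
    by (simp add: rigidity_minor_eq)
qed

section \<open>Generic placements\<close>

lemma finite_subset_bounded_gain_edges:
  assumes "finite F" "F \<subseteq> V \<times> V \<times> UNIV"
  shows "\<exists>k\<ge>1. F \<subseteq> bounded_gain_edges V k"
proof -
  define B where "B = (\<lambda>((v, w, g), c). nat \<bar>vec_nth g c\<bar>) ` (F \<times> UNIV)"
  have "finite B" using assms(1) by (simp add: B_def)
  then obtain k where k: "\<forall>b\<in>B. b \<le> k"
    by (auto simp: finite_nat_set_iff_bounded_le)
  \<comment> \<open>The successor keeps the bound at least \<open>1\<close>, as
    \<open>generic\<close> ranges over \<open>k \<ge> 1\<close>.\<close>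
  have "F \<subseteq> bounded_gain_edges V (Suc k)"
  proof
    fix e assume e: "e \<in> F"
    obtain v w g where e_eq: "e = (v, w, g)" by (cases e) auto
    have "- int (Suc k) \<le> vec_nth g c \<and> vec_nth g c \<le> int (Suc k)" for c
    proof -
      have "((v, w, g), c) \<in> F \<times> UNIV" using e e_eq by simp
      then have "nat \<bar>vec_nth g c\<bar> \<in> B" unfolding B_def by (rule rev_image_eqI) simp
      then have "nat \<bar>vec_nth g c\<bar> \<le> k" using k by blast
      then show ?thesis by linarith
    qed
    then show "e \<in> bounded_gain_edges V (Suc k)"
      using e e_eq assms(2) by (auto simp: bounded_gain_edges_def)
  qed
  then show ?thesis by (intro exI[of _ "Suc k"]) simp
qed

text \<open>Any finite list of edges fits under some bound \<open>k\<close>. Eliminating the bound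
  matters because integer shifts of the gains do not preserve a fixed \<open>k\<close>.\<close>

lemma generic_iff:
  fixes p :: "'v \<Rightarrow> real ^ 'd"
  shows "generic V p \<longleftrightarrow> (\<forall>es cs. distinct es \<and> set es \<subseteq> V \<times> V \<times> UNIV \<and> distinct cs \<and>
     set cs \<subseteq> V \<times> UNIV \<and> length cs = length es \<and> (\<exists>q. rigidity_minor es cs q \<noteq> 0)
     \<longrightarrow> rigidity_minor es cs p \<noteq> 0)"
  (is "_ \<longleftrightarrow> ?R")
proof
  assume gen: "generic V p"
  show ?R
  proof (intro allI impI)
    fix es :: "('v, 'd) gain_edge list" and cs
    assume *: "distinct es \<and> set es \<subseteq> V \<times> V \<times> UNIV \<and> distinct cs \<and>
      set cs \<subseteq> V \<times> UNIV \<and> length cs = length es \<and> (\<exists>q. rigidity_minor es cs q \<noteq> 0)"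
    then obtain k where k: "k \<ge> 1" "set es \<subseteq> bounded_gain_edges V k"
      using finite_subset_bounded_gain_edges[of "set es" V] by auto
    have "\<exists>q. independent_rows V q (set es)"
      using independent_rows_if_minor_nonzero * by blast
    then show "rigidity_minor es cs p \<noteq> 0"
      using gen k * unfolding generic_def exceptional_set_def by blast
  qed
next
  assume R: ?R
  have "bounded_gain_edges V k \<subseteq> V \<times> V \<times> UNIV" for k
    by (auto simp: bounded_gain_edges_def)
  with R show "generic V p"
    unfolding generic_def exceptional_set_def by blast
qed

text \<open>The placement \<open>p\<close> witnesses that a certain minor is not identically zero.
  Neither placement is confined to the unit cube, so the lemma applies to integer
  translates.\<close>

lemma infinitesimally_rigid_generic:
  assumes "fin_digraph G" "infinitesimally_rigid G m p" "generic (verts G) q"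
  shows "infinitesimally_rigid G m q"
proof (cases "verts G = {}")
  \<comment> \<open>There is no vertex to fix here, and rigidity is vacuous.\<close>
  case True
  then show ?thesis by (simp add: infinitesimally_rigid_def)
next
  case False
  interpret fin_digraph G by fact
  obtain r where r: "r \<in> verts G" using False by blast
  have "finite ((verts G - {r}) \<times> (UNIV :: 'c set))" by simp
  then obtain cs where cs: "distinct cs" "set cs = (verts G - {r}) \<times> (UNIV :: 'c set)"
    using finite_distinct_list by metis
  obtain es where es: "distinct es" "set es \<subseteq> gain_edges G m" "length es = length cs"
      "rigidity_minor es cs p \<noteq> 0"
    using assms(2) infinitesimally_rigid_iff_minor[OF assms(1) r cs] by blast
  have "gain_edges G m \<subseteq> verts G \<times> verts G \<times> UNIV"
    by (auto simp: gain_edges_def)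
  with es(2) have "set es \<subseteq> verts G \<times> verts G \<times> UNIV" by (rule subset_trans)
  moreover have "set cs \<subseteq> verts G \<times> UNIV" using cs(2) by auto
  ultimately have "rigidity_minor es cs q \<noteq> 0"
    using assms(3)[unfolded generic_iff, rule_format, of es cs] es cs(1) by force
  then show ?thesis
    using es infinitesimally_rigid_iff_minor[OF assms(1) r cs] by blast
qed

section \<open>Integer translations of the vertices\<close>

lemma real_vec_add: "real_vec (g + h) = real_vec g + real_vec h"
  and real_vec_diff: "real_vec (g - h) = real_vec g - real_vec h"
  and real_vec_uminus: "real_vec (- g) = - real_vec g"
  by (simp_all add: real_vec_def Finite_Cartesian_Product.vec_eq_iff)

text \<open>The sign is chosen so that the row of \<open>e\<close> at the placement translated by
  \<open>\<pi>\<close> is the row of the shifted edge at the original placement.\<close>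

fun shift_edge :: "('v \<Rightarrow> int ^ 'd) \<Rightarrow> ('v, 'd::finite) gain_edge \<Rightarrow> ('v, 'd) gain_edge" where
  "shift_edge \<pi> (v, w, g) = (v, w, g + \<pi> w - \<pi> v)"

lemma inj_shift_edge: "inj (shift_edge \<pi>)"
  by (rule injI) auto

lemma rigidity_entry_shift:
  "rigidity_entry (\<lambda>v. p v + real_vec (\<pi> v)) e c = rigidity_entry p (shift_edge \<pi> e) c"
  by (cases e; cases c)
    (simp add: real_vec_add real_vec_diff algebra_simps)

lemma rigidity_minor_shift:
  assumes "length cs = length es"
  shows "rigidity_minor es cs (\<lambda>v. p v + real_vec (\<pi> v))
       = rigidity_minor (map (shift_edge \<pi>) es) cs p"
  unfolding rigidity_minor_def
  by (intro arg_cong[of _ _ Determinant.det] eq_matI)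
    (auto simp: rigidity_entry_shift simp del: rigidity_entry.simps)

text \<open>Shifting is injective on edges and keeps their endpoints, so a minor at the translate is
  again an admissible minor at \<open>p\<close>.\<close>

lemma generic_shift:
  fixes p :: "'v \<Rightarrow> real ^ 'd"
  assumes "generic V p"
  shows "generic V (\<lambda>v. p v + real_vec (\<pi> v))"
  unfolding generic_iff
proof (intro allI impI)
  fix es :: "('v, 'd) gain_edge list" and cs
  assume *: "distinct es \<and> set es \<subseteq> V \<times> V \<times> UNIV \<and> distinct cs \<and>
    set cs \<subseteq> V \<times> UNIV \<and> length cs = length es \<and> (\<exists>q. rigidity_minor es cs q \<noteq> 0)"
  let ?es = "map (shift_edge \<pi>) es"
  obtain q where q: "rigidity_minor es cs q \<noteq> 0" using * by blast
  \<comment> \<open>Translating the witness \<open>q\<close> back by \<open>\<pi>\<close> shows that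
    the shifted minor is not identically zero.\<close>
  have "rigidity_minor ?es cs (\<lambda>v. q v - real_vec (\<pi> v)) \<noteq> 0"
    using rigidity_minor_shift[of cs es "\<lambda>v. q v - real_vec (\<pi> v)" \<pi>] q * by simp
  moreover have "distinct ?es"
    using * by (simp add: distinct_map inj_on_subset[OF inj_shift_edge])
  moreover have "set ?es \<subseteq> V \<times> V \<times> UNIV" using * by auto
  moreover have "length cs = length ?es" using * by simp
  ultimately have "rigidity_minor ?es cs p \<noteq> 0"
    using assms[unfolded generic_iff, rule_format, of ?es cs] * by blast
  then show "rigidity_minor es cs (\<lambda>v. p v + real_vec (\<pi> v)) \<noteq> 0"
    using rigidity_minor_shift[of cs es p \<pi>] * by simp
qed

section \<open>Switching the gains by a vertex potential\<close>

lemma infinitesimally_rigid_switch: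
  "infinitesimally_rigid G (\<lambda>e. \<pi> (tail G e) + m e - \<pi> (head G e)) p
    \<longleftrightarrow> infinitesimally_rigid G m (\<lambda>v. p v + real_vec (- \<pi> v))"
proof -
  have "p (tail G e) - p (head G e) - real_vec (\<pi> (tail G e) + m e - \<pi> (head G e))
      = (p (tail G e) + real_vec (- \<pi> (tail G e))) - (p (head G e) + real_vec (- \<pi> (head G e)))
        - real_vec (m e)" for e
    by (simp add: real_vec_add real_vec_diff real_vec_uminus)
  then show ?thesis
    by (simp only: infinitesimally_rigid_def infinitesimal_motion_def)
qed

text \<open>The translate of \<open>p\<close> may leave the unit cube, so the assumption is applied
  at \<open>p\<close> itself. Rigidity then passes to the translate, which is also generic.\<close>

lemma generically_rigid_switch_imp:
  assumes "generically_rigid G m"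
  shows "generically_rigid G (\<lambda>e. \<pi> (tail G e) + m e - \<pi> (head G e))"
  unfolding generically_rigid_def
proof (intro allI impI)
  fix p assume p: "torus_framework G (\<lambda>e. \<pi> (tail G e) + m e - \<pi> (head G e)) p
    \<and> generic (verts G) p"
  then have "fin_digraph G" "torus_framework G m p"
    by (simp_all add: torus_framework_def orbit_graph_def)
  then show "infinitesimally_rigid G (\<lambda>e. \<pi> (tail G e) + m e - \<pi> (head G e)) p"
    unfolding infinitesimally_rigid_switch
    using assms p generic_shift[of "verts G" p "\<lambda>v. - \<pi> v"] infinitesimally_rigid_generic
    unfolding generically_rigid_def by blast
qed

text \<open>Switching by \<open>- \<pi>\<close> undoes switching by \<open>\<pi>\<close>, so one
  implication gives both.\<close>

lemma generically_rigid_switch_iff: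
  "generically_rigid G (\<lambda>e. \<pi> (tail G e) + m e - \<pi> (head G e)) \<longleftrightarrow> generically_rigid G m"
proof -
  have "(\<lambda>e. - \<pi> (tail G e) + (\<pi> (tail G e) + m e - \<pi> (head G e)) - - \<pi> (head G e)) = m"
    by (rule ext) simp
  then show ?thesis
    using generically_rigid_switch_imp[of G m \<pi>]
      generically_rigid_switch_imp[of G "\<lambda>e. \<pi> (tail G e) + m e - \<pi> (head G e)" "\<lambda>v. - \<pi> v"]
    by (simp only:) blast
qed

theorem corollary4p29:
  fixes G T :: "('v, 'e) pre_digraph"
    and m :: "'e \<Rightarrow> int ^ 'd"
    and r :: 'v
  assumes "orbit_graph G m"
    and "undirected_spanning_tree T G"
    and "r \<in> verts G"
  shows "generically_rigid G m \<longleftrightarrow> generically_rigid G (T_gain G T r m)"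
  using generically_rigid_switch_iff[of G "T_potential T r m" m]
  unfolding T_gain_def by simp

end
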